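(* Let $\Gamma$ be a countable group with a length function $\mathcal{G}$. Assume that $(\Gamma,\mathcal{G})$ satisfies rapid decay of spherical shell correlations with polynomial parameter $\mathbf{b}\ge 0$, and has almost exact polynomial-exponential growth of spherical shells (with any fixed width $L\ge L_0>0$). Then the Hardy-Littlewood operator $\mathcal{M}$ for ball averages satisfies the weak-type $\mathcal{L}(\log\mathcal{L})^{\mathbf{c}}(\Gamma)$ maximal inequality, where $\mathbf{c}=2\mathbf{b}$.
   Context: A length function on a countable group $\Gamma$ is a function $\mathcal{G}:\Gamma\to[0,\infty)$ which is proper (each set $\{\mathcal{G}<r\}$ is finite), symmetric ($\mathcal{G}(u^{-1})=\mathcal{G}(u)$), subadditive ($\mathcal{G}(uv)\le\mathcal{G}(u)+\mathcal{G}(v)$) and satisfies $\mathcal{G}(e)=0$. Put $d_{\mathcal{G}}(u,v)=\mathcal{G}(u^{-1}v)$, $B_r=\{\gamma:\mathcal{G}(\gamma)<r\}$, and, for a width $L>0$, the spherical shells $SS_r=\{\gamma: r\le\mathcal{G}(\gamma)<r+L\}$. $|\cdot|$ of a set denotes cardinality. Almost exact polynomial-exponential growth of spherical shells: there exist $q>1$, an integer $d\ge 0$ and $L_0>0$ such that for every width $L\ge L_0$ there is $C_{gr}\ge 1$ (depending on $L$) with $C_{gr}^{-1}r^dq^r\le|SS_r|\le C_{gr}r^dq^r$ for all $r\ge1$. Rapid decay of spherical shell correlations with polynomial parameter $\mathbf{b}$: there is $L_0>0$ such that for every width $L\ge L_0$ there is $C_{cor}>0$ such that for all non-empty finite sets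 $A,B\subset\Gamma$ and all $r\ge1$, $|\{(u,v)\in A\times B: r\le d_{\mathcal{G}}(u,v)<r+L\}|\le C_{cor}\,r^{\mathbf{b}}\sqrt{|A|}\sqrt{|B|}\sqrt{|SS_r|}$. Hardy-Littlewood operator: for a fixed $r_0>0$, $\mathcal{M}f(x)=\sup_{r>r_0}\frac{1}{|B_r|}\sum_{u:\,d_{\mathcal{G}}(x,u)<r}|f(u)|$. For $\mathbf{c}>0$, $\mathcal{L}(\log\mathcal{L})^{\mathbf{c}}(\Gamma)$ is the space of functions $f$ on $\Gamma$ with $\sum_{x:\,|f(x)|>\eta}\frac{|f(x)|}{\eta}\left(\log\frac{|f(x)|}{\eta}\right)^{\mathbf{c}}<\infty$ for all $\eta>0$. $\mathcal{M}$ satisfies the weak-type $\mathcal{L}(\log\mathcal{L})^{\mathbf{c}}(\Gamma)$ maximal inequality if there is a constant $K>0$, independent of $f$, such that for every $\eta>0$, $$|\{x:\mathcal{M}f(x)\ge\eta\}|\le K\sum_{x:\,|f(x)|>\eta}\frac{|f(x)|}{\eta}\left(\log\frac{|f(x)|}{\eta}\right)^{\mathbf{c}}.$$ For $\mathbf{c}=0$ this means the weak-type $(1,1)$ maximal inequality: $|\{x:\mathcal{M}f(x)\ge\eta\}|\le\frac{K}{\eta}\|f\|_{\ell^1(\Gamma)}$ for all $\eta>0$.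
   Formalization: For c>0 the printed inequality fails in every group (take f=η·1_{B_R}, R>r_0: Mf(e)≥η but the sum over |f|>η is empty); proved instead: for every θ>1, |{Mf≥θη}| is bounded by K times the same sum, with K depending on θ but not on f or η. For c=0 nothing is changed. *)

theory Defs
  imports "HOL-Algebra.Group" "HOL-Analysis.Analysis"
begin

definition length_function :: "('a, 'b) monoid_scheme \<Rightarrow> ('a \<Rightarrow> real) \<Rightarrow> bool" where
  "length_function G \<G> \<longleftrightarrow>
     (\<forall>u\<in>carrier G. 0 \<le> \<G> u) \<and>
     (\<forall>r. finite {u \<in> carrier G. \<G> u < r}) \<and>
     (\<forall>u\<in>carrier G. \<G> (inv\<^bsub>G\<^esub> u) = \<G> u) \<and>
     (\<forall>u\<in>carrier G. \<forall>v\<in>carrier G. \<G> (u \<otimes>\<^bsub>G\<^esub> v) \<le> \<G> u + \<G> v) \<and>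
     \<G> \<one>\<^bsub>G\<^esub> = 0"

definition len_dist :: "('a, 'b) monoid_scheme \<Rightarrow> ('a \<Rightarrow> real) \<Rightarrow> 'a \<Rightarrow> 'a \<Rightarrow> real" where
  "len_dist G \<G> u v = \<G> (inv\<^bsub>G\<^esub> u \<otimes>\<^bsub>G\<^esub> v)"

definition len_ball :: "('a, 'b) monoid_scheme \<Rightarrow> ('a \<Rightarrow> real) \<Rightarrow> real \<Rightarrow> 'a set" where
  "len_ball G \<G> r = {u \<in> carrier G. \<G> u < r}"

definition shell :: "('a, 'b) monoid_scheme \<Rightarrow> ('a \<Rightarrow> real) \<Rightarrow> real \<Rightarrow> real \<Rightarrow> 'a set" where
  "shell G \<G> L r = {u \<in> carrier G. r \<le> \<G> u \<and> \<G> u < r + L}"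

definition almost_exact_growth :: "('a, 'b) monoid_scheme \<Rightarrow> ('a \<Rightarrow> real) \<Rightarrow> bool" where
  "almost_exact_growth G \<G> \<longleftrightarrow>
     (\<exists>(q::real)>1. \<exists>d::nat. \<exists>L0>0. \<forall>L\<ge>L0. \<exists>C\<ge>1. \<forall>r\<ge>1.
        inverse C * r ^ d * q powr r \<le> real (card (shell G \<G> L r)) \<and>
        real (card (shell G \<G> L r)) \<le> C * r ^ d * q powr r)"

definition rapid_decay_correlations ::
    "('a, 'b) monoid_scheme \<Rightarrow> ('a \<Rightarrow> real) \<Rightarrow> real \<Rightarrow> bool" where
  "rapid_decay_correlations G \<G> b \<longleftrightarrow>
     (\<exists>L0>0. \<forall>L\<ge>L0. \<exists>C>0. \<forall>A B. \<forall>r\<ge>1.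
        A \<subseteq> carrier G \<longrightarrow> finite A \<longrightarrow> A \<noteq> {} \<longrightarrow>
        B \<subseteq> carrier G \<longrightarrow> finite B \<longrightarrow> B \<noteq> {} \<longrightarrow>
        real (card {(u, v) \<in> A \<times> B. r \<le> len_dist G \<G> u v \<and> len_dist G \<G> u v < r + L})
          \<le> C * r powr b * sqrt (real (card A)) * sqrt (real (card B))
              * sqrt (real (card (shell G \<G> L r))))"

definition HL_maximal ::
    "('a, 'b) monoid_scheme \<Rightarrow> ('a \<Rightarrow> real) \<Rightarrow> real \<Rightarrow> ('a \<Rightarrow> complex) \<Rightarrow> 'a \<Rightarrow> ennreal" where
  "HL_maximal G \<G> r0 f x =
     (SUP r\<in>{r0<..}. ennreal
        ((\<Sum>u | u \<in> carrier G \<and> len_dist G \<G> x u < r. norm (f u)) / real (card (len_ball G \<G> r))))"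

definition LlogL_sum ::
    "('a, 'b) monoid_scheme \<Rightarrow> real \<Rightarrow> ('a \<Rightarrow> complex) \<Rightarrow> real \<Rightarrow> ennreal" where
  "LlogL_sum G c f \<eta> =
     (\<Sum>\<^sub>\<infinity>x\<in>{x \<in> carrier G. \<eta> < norm (f x)}.
        ennreal (norm (f x) / \<eta> * ln (norm (f x) / \<eta>) powr c))"

definition weak_type_1_1 :: "('a, 'b) monoid_scheme \<Rightarrow> ('a \<Rightarrow> real) \<Rightarrow> real \<Rightarrow> bool" where
  "weak_type_1_1 G \<G> r0 \<longleftrightarrow>
     (\<exists>K>0. \<forall>f. \<forall>\<eta>>0.
        emeasure (count_space UNIV) {x \<in> carrier G. ennreal \<eta> \<le> HL_maximal G \<G> r0 f x}
          \<le> ennreal (K / \<eta>) * (\<Sum>\<^sub>\<infinity>x\<in>carrier G. ennreal (norm (f x))))"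

text \<open>Membership of \<open>f\<close> in \<open>L (log L)^c\<close> is not assumed below: both sides take values in
  \<open>[0, \<infinity>]\<close>.\<close>

definition weak_type_LlogL_at ::
    "('a, 'b) monoid_scheme \<Rightarrow> ('a \<Rightarrow> real) \<Rightarrow> real \<Rightarrow> real \<Rightarrow> real \<Rightarrow> bool" where
  "weak_type_LlogL_at G \<G> r0 c \<theta> \<longleftrightarrow>
     (\<exists>K>0. \<forall>f. \<forall>\<eta>>0.
        emeasure (count_space UNIV) {x \<in> carrier G. ennreal (\<theta> * \<eta>) \<le> HL_maximal G \<G> r0 f x}
          \<le> ennreal K * LlogL_sum G c f \<eta>)"

text \<open>The inequality is often written with \<open>\<theta> = 1\<close>. Taken literally it then fails in every group:
  if \<open>f\<close> is \<open>\<eta>\<close> times the indicator of a large ball, then \<open>LlogL_sum G c f \<eta> = 0\<close> although the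
  maximal function reaches \<open>\<eta>\<close> at the identity. The next lemma records this.\<close>

lemma not_weak_type_LlogL_at_1:
  assumes "group G" and len: "length_function G \<G>" and "r0 > 0"
  shows "\<not> weak_type_LlogL_at G \<G> r0 c 1"
proof
  interpret group G by fact
  assume "weak_type_LlogL_at G \<G> r0 c 1"
  then obtain K where K: "\<And>f \<eta>. \<eta> > 0 \<Longrightarrow>
      emeasure (count_space UNIV) {x \<in> carrier G. ennreal \<eta> \<le> HL_maximal G \<G> r0 f x}
        \<le> ennreal K * LlogL_sum G c f \<eta>"
    unfolding weak_type_LlogL_at_def by auto
  define R where "R = r0 + 1"
  define f :: "'a \<Rightarrow> complex" where "f = indicator (len_ball G \<G> R)"
  have R: "R > r0" "R > 0" using \<open>r0 > 0\<close> by (auto simp: R_def)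
  have fin: "finite (len_ball G \<G> R)" and one: "\<one>\<^bsub>G\<^esub> \<in> len_ball G \<G> R"
    using len R by (auto simp: length_function_def len_ball_def)
  have card0: "card (len_ball G \<G> R) \<noteq> 0" using fin one by auto
  have ball: "{u. u \<in> carrier G \<and> len_dist G \<G> \<one>\<^bsub>G\<^esub> u < R} = len_ball G \<G> R"
    by (auto simp: len_dist_def len_ball_def)
  have "(\<Sum>u | u \<in> carrier G \<and> len_dist G \<G> \<one>\<^bsub>G\<^esub> u < R. norm (f u))
          / real (card (len_ball G \<G> R)) = 1"
    unfolding ball using card0 by (simp add: f_def)
  then have "ennreal 1 \<le> HL_maximal G \<G> r0 f \<one>\<^bsub>G\<^esub>"
    unfolding HL_maximal_def using R by (intro SUP_upper2[of R]) auto
  then have "{x \<in> carrier G. ennreal 1 \<le> HL_maximal G \<G> r0 f x} \<noteq> {}" by auto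
  moreover have none: "{x \<in> carrier G. 1 < norm (f x)} = {}"
    by (auto simp: f_def indicator_def)
  have "LlogL_sum G c f 1 = 0" unfolding LlogL_sum_def none by simp
  ultimately show False
    using K[of 1 f] by (auto simp: emeasure_count_space_eq_0)
qed

text \<open>So the inequality is required for every \<open>\<theta> > 1\<close>, with a constant depending on \<open>\<theta>\<close>. By homogeneity,
  this amounts to a constant inside the sum:
  replacing \<open>\<eta>\<close> by \<open>\<eta> / \<theta>\<close> gives level \<open>\<eta>\<close> on the left and \<open>\<eta> / \<theta>\<close> on the right.\<close>

definition weak_type_LlogL ::
    "('a, 'b) monoid_scheme \<Rightarrow> ('a \<Rightarrow> real) \<Rightarrow> real \<Rightarrow> real \<Rightarrow> bool" where
  "weak_type_LlogL G \<G> r0 c \<longleftrightarrow>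
     (if c = 0 then weak_type_1_1 G \<G> r0 else (\<forall>\<theta>>1. weak_type_LlogL_at G \<G> r0 c \<theta>))"

end

theory Submission
  imports Defs "HOL-Real_Asymp.Real_Asymp"
begin

text \<open>Let \<open>t k\<close> be the size, up to constants, of the shell of radius \<open>n k = 1 + k L\<close>, where \<open>L\<close> is so large
  that \<open>t (k + 1) \<ge> 8 t k\<close>. A large ball average forces a large average over one of the shells
  filling the ball, because the \<open>t k\<close> grow geometrically. Cut the range of the function, whose
  nonzero values may be taken to be at least \<open>1\<close>, into levels \<open>E j = {t j \<le> g < t (j + 1)}\<close>. If the
  average of \<open>g\<close> over the \<open>k\<close>-th shell around \<open>x\<close> is large, then either this shell meets some \<open>E j\<close> with
  \<open>j > k\<close>, which happens for at most about \<open>card (E j) * t k\<close> points \<open>x\<close>, or for some \<open>j \<le> k\<close> it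
  contains at least about \<open>2^(j - k) * t k / t j\<close> points of \<open>E j\<close>. By the correlation bound the
  latter happens for at most about \<open>(n k)^(2 b) * t j * card (E j) * 2^(j - k)\<close> points \<open>x\<close>. Both
  counts sum over \<open>k\<close> to at most about \<open>(n j)^(2 b) * t j * card (E j)\<close>, and \<open>n j\<close> is at most of order
  \<open>1 + ln g\<close> on \<open>E j\<close>.\<close>

lemma sum_geometric_growth_le:
  fixes t :: "nat \<Rightarrow> real"
  assumes "\<And>k. 0 \<le> t k" "\<And>k. 2 * t k \<le> t (Suc k)"
  shows "(\<Sum>k\<le>K. t k) \<le> 2 * t K"
proof (induction K)
  case 0
  then show ?case using assms(1)[of 0] by simp
next
  case (Suc K)
  then show ?case using assms(2)[of K] by simp
qed

lemma sum_UNION_le: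
  fixes g :: "'a \<Rightarrow> real"
  assumes "finite I" "\<And>i. i \<in> I \<Longrightarrow> finite (A i)" "\<And>i x. i \<in> I \<Longrightarrow> x \<in> A i \<Longrightarrow> 0 \<le> g x"
  shows "sum g (\<Union>i\<in>I. A i) \<le> (\<Sum>i\<in>I. sum g (A i))"
  using assms
proof (induction I rule: finite_induct)
  case (insert i I)
  have "sum g (A i \<union> (\<Union>i\<in>I. A i)) \<le> sum g (A i) + sum g (\<Union>i\<in>I. A i)"
    using insert.hyps insert.prems by (subst sum.union_inter[symmetric]) (auto intro!: sum_nonneg)
  then show ?case using insert by force
qed simp

lemma sum_inverse_power2_le: "(\<Sum>j\<le>k. (1/2::real) ^ (k - j)) \<le> 2"
proof (induction k)
  case (Suc k)
  have "(\<Sum>j\<le>k. (1/2::real) ^ (Suc k - j)) = (1/2) * (\<Sum>j\<le>k. (1/2) ^ (k - j))"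
    unfolding sum_distrib_left by (rule sum.cong) (auto simp: Suc_diff_le)
  with Suc show ?case by simp
qed auto

lemma summable_powr_half_power:
  assumes "0 < L"
  shows "summable (\<lambda>i. (1 + real i * L) powr c * (1/2) ^ i)"
proof (rule summable_comparison_test_bigo)
  show "summable (\<lambda>i. norm ((3/4::real) ^ i))" by simp
  show "(\<lambda>i. (1 + real i * L) powr c * (1/2) ^ i) \<in> O(\<lambda>i. (3/4::real) ^ i)"
    using assms by real_asymp
qed

lemma emeasure_count_space_le:
  assumes "\<And>X. finite X \<Longrightarrow> X \<subseteq> S \<Longrightarrow> real (card X) \<le> B"
  shows "emeasure (count_space UNIV) S \<le> ennreal B"
proof -
  have "finite S"
  proof (rule ccontr)
    assume "infinite S"
    then obtain X where "X \<subseteq> S" "finite X" "card X = Suc (nat \<lceil>B\<rceil>)"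
      using infinite_arbitrarily_large by blast
    with assms[of X] show False by linarith
  qed
  then show ?thesis
    using assms[of S] by (simp add: ennreal_of_nat_eq_real_of_nat ennreal_leI)
qed

lemma infsum_cmult_right_ennreal:
  fixes f :: "'a \<Rightarrow> ennreal"
  shows "(\<Sum>\<^sub>\<infinity>x\<in>A. c * f x) = c * (\<Sum>\<^sub>\<infinity>x\<in>A. f x)"
  by (simp add: nonneg_infsum_complete SUP_mult_left_ennreal sum_distrib_left)

locale shell_correlations = group G for G (structure) +
  fixes \<G> :: "'a \<Rightarrow> real" and L C D b :: real and t :: "nat \<Rightarrow> real"
  assumes len: "length_function G \<G>"
    and L_pos: "0 < L" and C_pos: "0 < C" and D_ge_1: "1 \<le> D" and b_nonneg: "0 \<le> b"
    and t_0: "t 0 = 1"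
    and t_growth: "8 * t k \<le> t (Suc k)"
    and t_Suc_le: "t (Suc k) \<le> D * t k"
    and t_le_shell: "t k \<le> C * real (card (shell G \<G> L (1 + real k * L)))"
    and shell_le_t: "real (card (shell G \<G> L (1 + real k * L))) \<le> C * t k"
    and correlations: "\<lbrakk>A \<subseteq> carrier G; finite A; A \<noteq> {}; B \<subseteq> carrier G; finite B; B \<noteq> {}\<rbrakk> \<Longrightarrow>
      real (card {(u, v) \<in> A \<times> B. 1 + real k * L \<le> len_dist G \<G> u v
                    \<and> len_dist G \<G> u v < 1 + real k * L + L})
        \<le> C * (1 + real k * L) powr b * sqrt (real (card A)) * sqrt (real (card B)) * sqrt (t k)"
begin

definition in_shell :: "nat \<Rightarrow> 'a \<Rightarrow> 'a \<Rightarrow> bool" where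
  "in_shell k x u \<longleftrightarrow> 1 + real k * L \<le> len_dist G \<G> x u \<and> len_dist G \<G> x u < 1 + real k * L + L"

lemma t_pos: "0 < t k"
proof (induction k)
  case (Suc k)
  then show ?case using t_growth[of k] by linarith
qed (simp add: t_0)

lemma t_shift: "8 ^ i * t j \<le> t (j + i)"
proof (induction i)
  case (Suc i)
  then show ?case using t_growth[of "j + i"] by simp
qed simp

lemma power8_le_t: "8 ^ j \<le> t j"
  using t_shift[of j 0] by (simp add: t_0)

lemma t_mono: "i \<le> j \<Longrightarrow> t i \<le> t j"
  by (rule lift_Suc_mono_le[of t]) (use t_growth t_pos in \<open>smt (verit)\<close>)

lemma sum_t_le: "(\<Sum>k\<le>K. t k) \<le> 2 * t K"
  by (rule sum_geometric_growth_le) (use t_growth t_pos in \<open>smt (verit)\<close>)+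

lemma finite_ball: "finite {u \<in> carrier G. \<G> u < r}"
  using len by (auto simp: length_function_def)

lemma finite_shell: "finite (shell G \<G> L r)"
  by (rule finite_subset[OF _ finite_ball[of "r + L"]]) (auto simp: shell_def)

lemma one_le_card_ball: "0 < r \<Longrightarrow> 1 \<le> real (card (len_ball G \<G> r))"
proof -
  assume "0 < r"
  then have "\<one> \<in> len_ball G \<G> r" using len by (auto simp: len_ball_def length_function_def)
  then have "card (len_ball G \<G> r) \<noteq> 0" using finite_ball[of r] by (auto simp: len_ball_def)
  then show ?thesis by linarith
qed

lemma card_dist_right_le:
  assumes "u \<in> carrier G" "X \<subseteq> carrier G" "finite {v \<in> carrier G. P (\<G> v)}"
  shows "card {x \<in> X. P (len_dist G \<G> x u)} \<le> card {v \<in> carrier G. P (\<G> v)}"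
proof (rule card_inj_on_le)
  show "inj_on (\<lambda>x. inv x \<otimes> u) {x \<in> X. P (len_dist G \<G> x u)}"
  proof (rule inj_onI)
    fix x y
    assume xy: "x \<in> {x \<in> X. P (len_dist G \<G> x u)}" "y \<in> {x \<in> X. P (len_dist G \<G> x u)}"
      and eq: "inv x \<otimes> u = inv y \<otimes> u"
    then have "x \<in> carrier G" "y \<in> carrier G" using assms(2) by auto
    with eq assms(1) show "x = y" by (metis inv_closed inv_inv right_cancel)
  qed
  show "(\<lambda>x. inv x \<otimes> u) ` {x \<in> X. P (len_dist G \<G> x u)} \<subseteq> {v \<in> carrier G. P (\<G> v)}"
    using assms by (auto simp: len_dist_def)
qed (use assms in auto)

lemma ball_at:
  assumes "x \<in> carrier G"
  shows "finite {u \<in> carrier G. len_dist G \<G> x u < r}" (is "finite ?B")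
    and "card {u \<in> carrier G. len_dist G \<G> x u < r} \<le> card (len_ball G \<G> r)"
proof -
  have inj: "inj_on (\<lambda>u. inv x \<otimes> u) ?B"
    using assms by (intro inj_onI) simp
  have img: "(\<lambda>u. inv x \<otimes> u) ` ?B \<subseteq> len_ball G \<G> r"
    using assms by (auto simp: len_dist_def len_ball_def)
  have fin: "finite (len_ball G \<G> r)" using finite_ball by (simp add: len_ball_def)
  show "finite ?B" using inj img fin by (rule inj_on_finite)
  show "card ?B \<le> card (len_ball G \<G> r)" using inj img fin by (rule card_inj_on_le)
qed

lemma card_many_in_shell_le:
  assumes X: "finite X" "X \<subseteq> carrier G" and E: "finite E" "E \<subseteq> carrier G" and "0 < a"
    and many: "\<And>x. x \<in> X \<Longrightarrow> a \<le> real (card {u \<in> E. in_shell k x u})"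
  shows "real (card X) \<le> C\<^sup>2 * (1 + real k * L) powr (2 * b) * real (card E) * t k / a\<^sup>2"
proof (cases "X = {}")
  case True
  then show ?thesis using C_pos t_pos[of k] by (auto intro!: divide_nonneg_nonneg mult_nonneg_nonneg)
next
  case False
  then obtain x where "x \<in> X" by auto
  with many[of x] \<open>0 < a\<close> have "E \<noteq> {}" by auto
  let ?n = "1 + real k * L"
  let ?X = "real (card X)" and ?E = "real (card E)"
  have square: "(?n powr b)\<^sup>2 = ?n powr (2 * b)"
    by (simp add: power2_eq_square flip: powr_add)
  have Xpos: "0 < ?X" using X False by (simp add: card_gt_0_iff)
  have "?X * a \<le> (\<Sum>x\<in>X. real (card {u \<in> E. in_shell k x u}))"
    using sum_bounded_below[of X a] many by auto
  also have "\<dots> = real (card (Sigma X (\<lambda>x. {u \<in> E. in_shell k x u})))"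
    using X E by simp
  also have "Sigma X (\<lambda>x. {u \<in> E. in_shell k x u}) = {(u, v) \<in> X \<times> E. ?n \<le> len_dist G \<G> u v
                    \<and> len_dist G \<G> u v < ?n + L}"
    by (auto simp: in_shell_def)
  also have "real (card \<dots>) \<le> C * ?n powr b * sqrt ?X * sqrt ?E * sqrt (t k)"
    using X E False \<open>E \<noteq> {}\<close> by (intro correlations)
  finally have "(?X * a)\<^sup>2 \<le> (C * ?n powr b * sqrt ?X * sqrt ?E * sqrt (t k))\<^sup>2"
    using \<open>0 < a\<close> by (intro power_mono) auto
  also have "\<dots> = C\<^sup>2 * ?n powr (2 * b) * ?X * ?E * t k"
    using t_pos[of k] by (simp add: power_mult_distrib square)
  finally have "?X * (?X * a\<^sup>2) \<le> ?X * (C\<^sup>2 * ?n powr (2 * b) * ?E * t k)"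
    by (simp add: power2_eq_square algebra_simps)
  then have "?X * a\<^sup>2 \<le> C\<^sup>2 * ?n powr (2 * b) * ?E * t k" using Xpos by simp
  then show ?thesis using \<open>0 < a\<close> by (simp add: field_simps)
qed

lemma exists_level:
  assumes "1 \<le> y"
  obtains j where "t j \<le> y" "y < t (Suc j)"
proof -
  obtain n where "y < 8 ^ n" using real_arch_pow[of 8 y] by auto
  then have "y < t n" using power8_le_t[of n] by linarith
  then have ex: "\<exists>n. y < t n" by blast
  define m where "m = (LEAST n. y < t n)"
  have m: "y < t m" unfolding m_def using ex by (rule LeastI_ex)
  then obtain j where j: "m = Suc j" using assms t_0 by (cases m) auto
  have "\<not> y < t j" using not_less_Least[of j "\<lambda>n. y < t n"] j by (simp add: m_def)
  with m j show thesis by (intro that[of j]) auto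
qed

lemma radius_le_ln:
  assumes "t j \<le> y"
  shows "1 + real j * L \<le> (1 + L) * (1 + ln y)"
proof -
  have "8 ^ j \<le> y" using assms power8_le_t[of j] by linarith
  then have "real j * ln 8 \<le> ln y"
    by (metis ln_mono ln_realpow zero_less_numeral zero_less_power)
  moreover have "exp 1 \<le> (8::real)" using exp_le by linarith
  then have "1 \<le> ln (8::real)" by (simp add: ln_ge_iff)
  then have "real j * 1 \<le> real j * ln 8" by (intro mult_left_mono) auto
  ultimately have j: "real j \<le> ln y" by linarith
  then have jL: "real j * L \<le> ln y * L" using L_pos by (intro mult_right_mono) auto
  have "(1 + L) * (1 + ln y) = 1 + L + ln y + ln y * L" by (simp add: algebra_simps)
  then show ?thesis using j jL L_pos by linarith
qed

lemma large_ball_sum_cases: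
  fixes g :: "'a \<Rightarrow> real"
  assumes x: "x \<in> carrier G" and E: "finite E" "E \<subseteq> carrier G" and g: "\<And>u. u \<in> E \<Longrightarrow> 0 \<le> g u"
    and "0 < r" "0 < \<alpha>"
    and large: "\<alpha> * real (card (len_ball G \<G> r)) < (\<Sum>u | u \<in> E \<and> len_dist G \<G> x u < r. g u)"
    and \<kappa>: "\<kappa> * (3 * (1 + C * D)) = \<alpha>"
  shows "\<kappa> < (\<Sum>u | u \<in> E \<and> len_dist G \<G> x u < 1. g u) \<or>
    (\<exists>k. \<kappa> * t k < (\<Sum>u | u \<in> E \<and> in_shell k x u. g u))"
proof (rule ccontr)
  assume "\<not> ?thesis"
  then have near: "(\<Sum>u | u \<in> E \<and> len_dist G \<G> x u < 1. g u) \<le> \<kappa>"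
    and far: "\<And>k. (\<Sum>u | u \<in> E \<and> in_shell k x u. g u) \<le> \<kappa> * t k"
    by (auto simp: not_less)
  have CD: "0 < C * D" using C_pos D_ge_1 by simp
  have \<kappa>pos: "0 < \<kappa>"
    using \<kappa> CD \<open>0 < \<alpha>\<close> zero_less_mult_pos2[of \<kappa> "3 * (1 + C * D)"] by simp
  define m where "m = nat \<lfloor>max 0 ((r - 1) / L)\<rfloor>"
  have m_le: "real m \<le> max 0 ((r - 1) / L)" and m_gt: "(r - 1) / L < real m + 1"
    unfolding m_def by linarith+
  have r_less: "r < 1 + real (Suc m) * L"
    using m_gt L_pos by (simp add: field_simps)
  have ball: "t m \<le> (1 + C * D) * real (card (len_ball G \<G> r))"
  proof (cases m)
    case 0
    have "1 * 1 \<le> (1 + C * D) * real (card (len_ball G \<G> r))"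
      using one_le_card_ball[OF \<open>0 < r\<close>] CD by (intro mult_mono) auto
    then show ?thesis using 0 by (simp add: t_0)
  next
    case (Suc i)
    then have "real (Suc i) \<le> (r - 1) / L" using m_le by (auto simp: max_def split: if_splits)
    then have "1 + real i * L + L \<le> r" using L_pos by (simp add: field_simps)
    then have "shell G \<G> L (1 + real i * L) \<subseteq> len_ball G \<G> r"
      by (auto simp: shell_def len_ball_def)
    then have "card (shell G \<G> L (1 + real i * L)) \<le> card (len_ball G \<G> r)"
      using finite_ball by (intro card_mono) (auto simp: len_ball_def)
    then have "C * real (card (shell G \<G> L (1 + real i * L))) \<le> C * real (card (len_ball G \<G> r))"
      using C_pos by simp
    then have "D * t i \<le> D * (C * real (card (len_ball G \<G> r)))"
      using t_le_shell[of i] D_ge_1 by (intro mult_left_mono) auto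
    moreover have "0 \<le> real (card (len_ball G \<G> r))" by simp
    ultimately show ?thesis using t_Suc_le[of i] Suc by (simp add: algebra_simps)
  qed
  let ?S = "\<lambda>k. {u. u \<in> E \<and> in_shell k x u}"
  let ?N = "{u. u \<in> E \<and> len_dist G \<G> x u < 1}"
  have cover: "{u. u \<in> E \<and> len_dist G \<G> x u < r} \<subseteq> ?N \<union> (\<Union>k\<in>{..m}. ?S k)"
  proof (intro subsetI)
    fix u assume u: "u \<in> {u. u \<in> E \<and> len_dist G \<G> x u < r}"
    let ?d = "len_dist G \<G> x u"
    show "u \<in> ?N \<union> (\<Union>k\<in>{..m}. ?S k)"
    proof (cases "?d < 1")
      case False
      define k where "k = nat \<lfloor>(?d - 1) / L\<rfloor>"
      have "0 \<le> (?d - 1) / L" using False L_pos by simp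
      then have "real k \<le> (?d - 1) / L" "(?d - 1) / L < real k + 1" unfolding k_def by linarith+
      then have k: "1 + real k * L \<le> ?d" "?d < 1 + real k * L + L" using L_pos by (simp_all add: field_simps)
      have "1 + real k * L < 1 + real (Suc m) * L" using k(1) u r_less by auto
      then have "k < Suc m" using L_pos by simp
      then show ?thesis using u k by (auto simp: in_shell_def)
    qed (use u in auto)
  qed
  have "(\<Sum>u | u \<in> E \<and> len_dist G \<G> x u < r. g u) \<le> (\<Sum>u\<in>?N \<union> (\<Union>k\<in>{..m}. ?S k). g u)"
    using cover E g by (intro sum_mono2) auto
  also have "\<dots> \<le> (\<Sum>u\<in>?N. g u) + (\<Sum>u\<in>(\<Union>k\<in>{..m}. ?S k). g u)"
    using E g by (subst sum.union_inter[symmetric]) (auto intro!: sum_nonneg)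
  also have "(\<Sum>u\<in>(\<Union>k\<in>{..m}. ?S k). g u) \<le> (\<Sum>k\<le>m. \<Sum>u\<in>?S k. g u)"
    using E g by (intro sum_UNION_le) auto
  also have "\<dots> \<le> (\<Sum>k\<le>m. \<kappa> * t k)" using far by (intro sum_mono) auto
  also have "\<dots> \<le> \<kappa> * (2 * t m)"
    unfolding sum_distrib_left[symmetric] using sum_t_le[of m] \<kappa>pos by simp
  also have "(\<Sum>u\<in>?N. g u) + \<kappa> * (2 * t m) \<le> 3 * \<kappa> * t m"
  proof -
    have "\<kappa> * 1 \<le> \<kappa> * t m"
      using t_mono[of 0 m] t_0 \<kappa>pos by (intro mult_left_mono) auto
    then show ?thesis using near by linarith
  qed
  also have "\<dots> \<le> 3 * \<kappa> * ((1 + C * D) * real (card (len_ball G \<G> r)))"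
    using ball \<kappa>pos by (intro mult_left_mono) auto
  also have "\<dots> = \<alpha> * real (card (len_ball G \<G> r))"
    unfolding \<kappa>[symmetric] by (simp add: algebra_simps)
  finally show False using large by simp
qed

definition level :: "'a set \<Rightarrow> ('a \<Rightarrow> real) \<Rightarrow> nat \<Rightarrow> 'a set" where
  "level E g j = {u \<in> E. t j \<le> g u \<and> g u < t (Suc j)}"

lemma level_subset: "level E g j \<subseteq> E"
  by (auto simp: level_def)

lemma level_disjoint: "i \<noteq> j \<Longrightarrow> level E g i \<inter> level E g j = {}"
proof (induction i j rule: linorder_wlog)
  case (le i j)
  then show ?case using t_mono[of "Suc i" j] by (auto simp: level_def)
qed (auto simp: Int_commute)

lemma sum_levels_le:
  fixes h :: "'a \<Rightarrow> real"
  assumes "finite E" "\<And>u. u \<in> E \<Longrightarrow> 0 \<le> h u"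
  shows "(\<Sum>j\<le>M. \<Sum>u\<in>level E g j. h u) \<le> (\<Sum>u\<in>E. h u)"
proof -
  have fin: "finite (level E g j)" for j using level_subset assms(1) by (rule finite_subset)
  have "(\<Sum>j\<le>M. \<Sum>u\<in>level E g j. h u) = sum h (\<Union>j\<le>M. level E g j)"
    using fin level_disjoint by (intro sum.UNION_disjoint[symmetric]) auto
  also have "\<dots> \<le> (\<Sum>u\<in>E. h u)"
    using assms by (intro sum_mono2) (auto simp: level_def)
  finally show ?thesis .
qed

lemma large_shell_sum_cases:
  fixes g :: "'a \<Rightarrow> real"
  assumes E: "finite E" and g: "\<And>u. u \<in> E \<Longrightarrow> 1 \<le> g u" and "0 < \<kappa>"
    and large: "\<kappa> * t k < (\<Sum>u | u \<in> E \<and> in_shell k x u. g u)"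
  shows "(\<exists>j>k. \<exists>u\<in>level E g j. in_shell k x u) \<or>
    (\<exists>j\<le>k. \<kappa> / (2 * D) * (1/2) ^ (k - j) * t k / t j \<le> real (card {u \<in> level E g j. in_shell k x u}))"
proof (rule ccontr)
  assume "\<not> ?thesis"
  then have neg: "\<not> (\<exists>j>k. \<exists>u\<in>level E g j. in_shell k x u)"
      "\<not> (\<exists>j\<le>k. \<kappa> / (2 * D) * (1/2) ^ (k - j) * t k / t j \<le> real (card {u \<in> level E g j. in_shell k x u}))"
    by blast+
  from neg(1) have above: "\<And>j u. k < j \<Longrightarrow> u \<in> level E g j \<Longrightarrow> \<not> in_shell k x u" by blast
  from neg(2) have below: "\<And>j. j \<le> k \<Longrightarrow>
      real (card {u \<in> level E g j. in_shell k x u}) < \<kappa> / (2 * D) * (1/2) ^ (k - j) * t k / t j"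
    unfolding not_le[symmetric] by blast
  let ?S = "\<lambda>j. {u \<in> level E g j. in_shell k x u}"
  have fin: "finite (?S j)" for j using E by (simp add: level_def)
  have "(\<Sum>u | u \<in> E \<and> in_shell k x u. g u) \<le> (\<Sum>u\<in>(\<Union>j\<in>{..k}. ?S j). g u)"
  proof (rule sum_mono2)
    show "{u. u \<in> E \<and> in_shell k x u} \<subseteq> (\<Union>j\<in>{..k}. ?S j)"
    proof safe
      fix u assume u: "u \<in> E" "in_shell k x u"
      obtain j where "t j \<le> g u" "g u < t (Suc j)" using g[OF u(1)] by (rule exists_level)
      then have "u \<in> level E g j" using u by (simp add: level_def)
      with u above[of j u] show "u \<in> (\<Union>j\<in>{..k}. ?S j)" by force
    qed
    show "0 \<le> g u" if "u \<in> (\<Union>j\<in>{..k}. ?S j) - {u. u \<in> E \<and> in_shell k x u}" for u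
      using that level_subset by auto
  qed (use fin in auto)
  also have "\<dots> \<le> (\<Sum>j\<le>k. \<Sum>u\<in>?S j. g u)"
  proof (rule sum_UNION_le)
    show "0 \<le> g u" if "u \<in> ?S j" for j u
      using that t_pos[of j] by (simp add: level_def)
  qed (use fin in auto)
  also have "\<dots> \<le> (\<Sum>j\<le>k. \<kappa> / 2 * t k * (1/2) ^ (k - j))"
  proof (rule sum_mono)
    fix j assume "j \<in> {..k}"
    have "(\<Sum>u\<in>?S j. g u) \<le> real (card (?S j)) * (D * t j)"
      using t_Suc_le[of j] by (intro sum_bounded_above) (auto simp: level_def)
    also have "\<dots> \<le> \<kappa> / (2 * D) * (1/2) ^ (k - j) * t k / t j * (D * t j)"
      using below[of j] \<open>j \<in> {..k}\<close> D_ge_1 t_pos[of j] by (intro mult_right_mono) auto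
    also have "\<dots> = \<kappa> / 2 * t k * (1/2) ^ (k - j)"
      using D_ge_1 t_pos[of j] by (simp add: field_simps)
    finally show "(\<Sum>u\<in>?S j. g u) \<le> \<kappa> / 2 * t k * (1/2) ^ (k - j)" .
  qed
  also have "\<dots> \<le> \<kappa> / 2 * t k * 2"
    unfolding sum_distrib_left[symmetric]
    using sum_inverse_power2_le[of k] \<open>0 < \<kappa>\<close> t_pos[of k] by (intro mult_left_mono) auto
  finally show False using large by simp
qed

lemma card_large_unit_ball_sum_le:
  fixes g :: "'a \<Rightarrow> real"
  assumes X: "finite X" "X \<subseteq> carrier G" and E: "finite E" "E \<subseteq> carrier G"
    and g: "\<And>u. u \<in> E \<Longrightarrow> 0 \<le> g u" and "0 < \<kappa>"
    and large: "\<And>x. x \<in> X \<Longrightarrow> \<kappa> < (\<Sum>u | u \<in> E \<and> len_dist G \<G> x u < 1. g u)"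
  shows "real (card X) \<le> real (card (len_ball G \<G> 1)) / \<kappa> * (\<Sum>u\<in>E. g u)"
proof -
  have "real (card X) * \<kappa> \<le> (\<Sum>x\<in>X. \<Sum>u | u \<in> E \<and> len_dist G \<G> x u < 1. g u)"
    using less_imp_le[OF large] by (rule sum_bounded_below)
  also have "\<dots> = (\<Sum>u\<in>E. \<Sum>x | x \<in> X \<and> len_dist G \<G> x u < 1. g u)"
    using X(1) E(1) by (rule sum.swap_restrict)
  also have "\<dots> \<le> (\<Sum>u\<in>E. real (card (len_ball G \<G> 1)) * g u)"
  proof (rule sum_mono)
    fix u assume u: "u \<in> E"
    have "card {x \<in> X. len_dist G \<G> x u < 1} \<le> card (len_ball G \<G> 1)"
      using card_dist_right_le[of u X "\<lambda>y. y < 1"] finite_ball[of 1] u E X by (auto simp: len_ball_def)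
    then show "(\<Sum>x | x \<in> X \<and> len_dist G \<G> x u < 1. g u) \<le> real (card (len_ball G \<G> 1)) * g u"
      using g[OF u] by (simp add: mult_right_mono)
  qed
  also have "\<dots> = real (card (len_ball G \<G> 1)) * (\<Sum>u\<in>E. g u)"
    by (rule sum_distrib_left[symmetric])
  finally show ?thesis using \<open>0 < \<kappa>\<close> by (simp add: field_simps)
qed

lemma card_meeting_shell_le:
  assumes X: "finite X" "X \<subseteq> carrier G" and E: "finite E" "E \<subseteq> carrier G"
  shows "real (card {x \<in> X. \<exists>u\<in>E. in_shell k x u}) \<le> real (card E) * (C * t k)"
proof -
  have "card {x \<in> X. \<exists>u\<in>E. in_shell k x u} = card (\<Union>u\<in>E. {x \<in> X. in_shell k x u})"
    by (rule arg_cong[where f = card]) auto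
  also have "\<dots> \<le> (\<Sum>u\<in>E. card {x \<in> X. in_shell k x u})"
    using E by (intro card_UN_le)
  also have "\<dots> \<le> (\<Sum>u\<in>E. card (shell G \<G> L (1 + real k * L)))"
  proof (rule sum_mono)
    fix u assume "u \<in> E"
    then show "card {x \<in> X. in_shell k x u} \<le> card (shell G \<G> L (1 + real k * L))"
      using card_dist_right_le[of u X "\<lambda>y. 1 + real k * L \<le> y \<and> y < 1 + real k * L + L"]
        finite_shell[of "1 + real k * L"] E(2) X(2)
      unfolding in_shell_def shell_def by blast
  qed
  finally have "card {x \<in> X. \<exists>u\<in>E. in_shell k x u} \<le> card E * card (shell G \<G> L (1 + real k * L))"
    by simp
  then have "real (card {x \<in> X. \<exists>u\<in>E. in_shell k x u})
      \<le> real (card E) * real (card (shell G \<G> L (1 + real k * L)))"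
    unfolding of_nat_mult[symmetric] of_nat_le_iff .
  also have "\<dots> \<le> real (card E) * (C * t k)"
    using shell_le_t[of k] by (intro mult_left_mono) auto
  finally show ?thesis .
qed

lemma card_many_in_later_shell_le:
  assumes X: "finite X" "X \<subseteq> carrier G" and E: "finite E" "E \<subseteq> carrier G" and "0 < \<kappa>"
    and many: "\<And>x. x \<in> X \<Longrightarrow>
      \<kappa> * (1/2) ^ i * t (j + i) / t j \<le> real (card {u \<in> E. in_shell (j + i) x u})"
  shows "real (card X) \<le> C\<^sup>2 / \<kappa>\<^sup>2 * (real (card E) * t j * (1 + real j * L) powr (2 * b))
           * ((1 + real i * L) powr (2 * b) * (1/2) ^ i)"
proof -
  let ?n = "\<lambda>i. (1 + real i * L) powr (2 * b)"
  let ?a = "\<kappa> * (1/2) ^ i * t (j + i) / t j"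
  have pos: "0 < t j" "0 < t (j + i)" by (rule t_pos)+
  have "real (card X) \<le> C\<^sup>2 * ?n (j + i) * real (card E) * t (j + i) / ?a\<^sup>2"
    by (rule card_many_in_shell_le[OF X E _ many]) (use pos \<open>0 < \<kappa>\<close> in auto)
  also have "\<dots> = C\<^sup>2 / \<kappa>\<^sup>2 * real (card E) * t j * (?n (j + i) * (4 ^ i * t j / t (j + i)))"
  proof -
    have "((1/2::real) ^ i)\<^sup>2 = (1/4) ^ i"
      by (simp add: power2_eq_square flip: power_mult_distrib)
    then have "?a\<^sup>2 = \<kappa>\<^sup>2 * (t (j + i))\<^sup>2 / (4 ^ i * (t j)\<^sup>2)"
      by (simp add: power_mult_distrib power_divide)
    then show ?thesis using pos \<open>0 < \<kappa>\<close>
      by (simp only:) (simp add: power2_eq_square mult_ac)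
  qed
  also have "\<dots> \<le> C\<^sup>2 / \<kappa>\<^sup>2 * real (card E) * t j * ((?n j * ?n i) * (1/2) ^ i)"
  proof (intro mult_left_mono mult_mono)
    have "1 + real (j + i) * L \<le> (1 + real j * L) * (1 + real i * L)"
      using L_pos by (simp add: algebra_simps)
    then have "?n (j + i) \<le> ((1 + real j * L) * (1 + real i * L)) powr (2 * b)"
      using L_pos b_nonneg by (intro powr_mono2) auto
    also have "\<dots> = ?n j * ?n i"
      by (rule powr_mult)
    finally show "?n (j + i) \<le> ?n j * ?n i" .
    have "4 ^ i * t j * 2 ^ i = 8 ^ i * t j"
      by (simp flip: power_mult_distrib)
    also have "\<dots> \<le> t (j + i)" by (rule t_shift)
    finally show "4 ^ i * t j / t (j + i) \<le> (1/2) ^ i"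
      using pos by (simp add: field_simps)
  qed (use pos in auto)
  finally show ?thesis by (simp add: algebra_simps)
qed

theorem card_large_average_le:
  assumes "0 < \<alpha>"
  obtains K where "0 < K"
    "\<And>E g X. \<lbrakk>finite E; E \<subseteq> carrier G; \<And>u. u \<in> E \<Longrightarrow> 1 \<le> g u; finite X; X \<subseteq> carrier G;
        \<And>x. x \<in> X \<Longrightarrow>
          \<exists>r>0. \<alpha> * real (card (len_ball G \<G> r)) < (\<Sum>u | u \<in> E \<and> len_dist G \<G> x u < r. g u)\<rbrakk>
      \<Longrightarrow> real (card X) \<le> K * (\<Sum>u\<in>E. g u * (1 + ln (g u)) powr (2 * b))"
proof -
  define \<kappa> where "\<kappa> = \<alpha> / (3 * (1 + C * D))"
  have CD: "0 < C * D" using C_pos D_ge_1 by simp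
  have \<kappa>: "0 < \<kappa>" "\<kappa> * (3 * (1 + C * D)) = \<alpha>" using assms CD by (auto simp: \<kappa>_def)
  define \<kappa>' where "\<kappa>' = \<kappa> / (2 * D)"
  have \<kappa>': "0 < \<kappa>'" using \<kappa> D_ge_1 by (simp add: \<kappa>'_def)
  let ?n = "\<lambda>i. (1 + real i * L) powr (2 * b)"
  define Z where "Z = (\<Sum>i. ?n i * (1/2) ^ i)"
  have Z: "(\<Sum>i\<le>M. ?n i * (1/2) ^ i) \<le> Z" for M
    unfolding Z_def by (rule sum_le_suminf[OF summable_powr_half_power[OF L_pos]]) auto
  then have Z0: "0 \<le> Z" using Z[of 0] by simp
  define K0 where "K0 = real (card (len_ball G \<G> 1)) / \<kappa>"
  define K1 where "K1 = C\<^sup>2 / \<kappa>'\<^sup>2 * Z * (1 + L) powr (2 * b)"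
  have K0: "0 \<le> K0" and K1: "0 \<le> K1" using \<kappa> \<kappa>' Z0 by (simp_all add: K0_def K1_def)
  show thesis
  proof (rule that[of "K0 + 2 * C + K1"])
    show "0 < K0 + 2 * C + K1" using K0 K1 C_pos by simp
  next
    fix E :: "'a set" and g :: "'a \<Rightarrow> real" and X :: "'a set"
    assume E: "finite E" "E \<subseteq> carrier G" and g: "\<And>u. u \<in> E \<Longrightarrow> 1 \<le> g u"
      and X: "finite X" "X \<subseteq> carrier G" and large: "\<And>x. x \<in> X \<Longrightarrow>
          \<exists>r>0. \<alpha> * real (card (len_ball G \<G> r)) < (\<Sum>u | u \<in> E \<and> len_dist G \<G> x u < r. g u)"
    let ?W = "\<lambda>u. g u * (1 + ln (g u)) powr (2 * b)"
    let ?E = "level E g"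
    have fin: "finite (?E j)" "?E j \<subseteq> carrier G" for j
      using E by (auto simp: level_def)
    have g_le_W: "g u \<le> ?W u" if "u \<in> E" for u
    proof -
      have "1 \<le> (1 + ln (g u)) powr (2 * b)"
        using g[OF that] b_nonneg by (intro ge_one_powr_ge_zero) auto
      then show ?thesis using g[OF that] mult_left_mono[of 1 _ "g u"] by simp
    qed
    have W0: "0 \<le> ?W u" if "u \<in> E" for u using g[OF that] by simp
    define X0 where "X0 = {x \<in> X. \<kappa> < (\<Sum>u | u \<in> E \<and> len_dist G \<G> x u < 1. g u)}"
    define XA where "XA k j = {x \<in> X. \<exists>u\<in>?E j. in_shell k x u}" for k j
    define XB where "XB j i = {x \<in> X. \<kappa>' * (1/2) ^ i * t (j + i) / t j
        \<le> real (card {u \<in> ?E j. in_shell (j + i) x u})}" for j i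
    have sub: "X0 \<subseteq> X" "XA k j \<subseteq> X" "XB j i \<subseteq> X" for k j i
      by (auto simp: X0_def XA_def XB_def)
    have finX: "finite X0" "finite (XA k j)" "finite (XB j i)" for k j i
      using sub[THEN finite_subset, OF X(1)] by blast+
    define covers where "covers x p \<longleftrightarrow>
        x \<in> X0 \<or> snd p < fst p \<and> x \<in> XA (snd p) (fst p) \<or> x \<in> XB (fst p) (snd p)"
      for x and p :: "nat \<times> nat"
    have "\<exists>p. covers x p" if x: "x \<in> X" for x
    proof (cases "x \<in> X0")
      case False
      obtain r where "0 < r" "\<alpha> * real (card (len_ball G \<G> r)) < (\<Sum>u | u \<in> E \<and> len_dist G \<G> x u < r. g u)"
        using large[OF x] by auto
      from large_ball_sum_cases[OF _ E _ this(1) assms this(2) \<kappa>(2)] x X g False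
      obtain k where "\<kappa> * t k < (\<Sum>u | u \<in> E \<and> in_shell k x u. g u)"
        by (force simp: X0_def)
      from large_shell_sum_cases[OF E(1) g \<kappa>(1) this]
      consider j where "k < j" "x \<in> XA k j" | j where "j \<le> k" "x \<in> XB j (k - j)"
        using x by (auto simp: XA_def XB_def \<kappa>'_def)
      then show ?thesis
      proof cases
        case (1 j)
        then show ?thesis by (intro exI[of _ "(j, k)"]) (simp add: covers_def)
      next
        case (2 j)
        then show ?thesis by (intro exI[of _ "(j, k - j)"]) (simp add: covers_def)
      qed
    qed (simp add: covers_def)
    then obtain p where p: "\<And>x. x \<in> X \<Longrightarrow> covers x (p x)" by metis
    define M where "M = (\<Sum>x\<in>X. fst (p x) + snd (p x))"
    have M: "fst (p x) + snd (p x) \<le> M" if "x \<in> X" for x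
      unfolding M_def using X(1) that by (intro member_le_sum) simp_all
    have "X \<subseteq> X0 \<union> ((\<Union>j\<in>{..M}. \<Union>k\<in>{..<j}. XA k j) \<union> (\<Union>j\<in>{..M}. \<Union>i\<in>{..M}. XB j i))"
    proof
      fix x assume x: "x \<in> X"
      have "fst (p x) \<le> M" "snd (p x) \<le> M" using M[OF x] by linarith+
      then show "x \<in> X0 \<union> ((\<Union>j\<in>{..M}. \<Union>k\<in>{..<j}. XA k j) \<union> (\<Union>j\<in>{..M}. \<Union>i\<in>{..M}. XB j i))"
        using p[OF x] unfolding covers_def by blast
    qed
    then have "card X \<le> card (X0 \<union> ((\<Union>j\<in>{..M}. \<Union>k\<in>{..<j}. XA k j) \<union> (\<Union>j\<in>{..M}. \<Union>i\<in>{..M}. XB j i)))"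
      using finX by (intro card_mono) simp_all
    also have "\<dots> \<le> card X0 + (card (\<Union>j\<in>{..M}. \<Union>k\<in>{..<j}. XA k j) + card (\<Union>j\<in>{..M}. \<Union>i\<in>{..M}. XB j i))"
      by (rule order_trans[OF card_Un_le add_left_mono[OF card_Un_le]])
    also have "\<dots> \<le> card X0 + ((\<Sum>j\<le>M. \<Sum>k<j. card (XA k j)) + (\<Sum>j\<le>M. \<Sum>i\<le>M. card (XB j i)))"
    proof (rule add_left_mono, rule add_mono)
      have "card (\<Union>j\<in>{..M}. \<Union>k\<in>{..<j}. XA k j) \<le> (\<Sum>j\<le>M. card (\<Union>k\<in>{..<j}. XA k j))"
        by (rule card_UN_le) simp
      also have "\<dots> \<le> (\<Sum>j\<le>M. \<Sum>k<j. card (XA k j))"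
        by (rule sum_mono, rule card_UN_le) simp
      finally show "card (\<Union>j\<in>{..M}. \<Union>k\<in>{..<j}. XA k j) \<le> (\<Sum>j\<le>M. \<Sum>k<j. card (XA k j))" .
      have "card (\<Union>j\<in>{..M}. \<Union>i\<in>{..M}. XB j i) \<le> (\<Sum>j\<le>M. card (\<Union>i\<in>{..M}. XB j i))"
        by (rule card_UN_le) simp
      also have "\<dots> \<le> (\<Sum>j\<le>M. \<Sum>i\<le>M. card (XB j i))"
        by (rule sum_mono, rule card_UN_le) simp
      finally show "card (\<Union>j\<in>{..M}. \<Union>i\<in>{..M}. XB j i) \<le> (\<Sum>j\<le>M. \<Sum>i\<le>M. card (XB j i))" .
    qed
    finally have "real (card X) \<le> real (card X0) +
        ((\<Sum>j\<le>M. \<Sum>k<j. real (card (XA k j))) + (\<Sum>j\<le>M. \<Sum>i\<le>M. real (card (XB j i))))"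
      by (simp only: of_nat_sum[symmetric] of_nat_add[symmetric] of_nat_le_iff)
    also have "real (card X0) \<le> K0 * (\<Sum>u\<in>E. ?W u)"
    proof -
      have "real (card X0) \<le> K0 * (\<Sum>u\<in>E. g u)"
        unfolding K0_def
      proof (rule card_large_unit_ball_sum_le)
        show "0 \<le> g u" if "u \<in> E" for u using g[OF that] by simp
      qed (use X E \<kappa> sub in \<open>auto simp: X0_def\<close>)
      also have "\<dots> \<le> K0 * (\<Sum>u\<in>E. ?W u)"
        using g_le_W K0 by (intro mult_left_mono sum_mono) auto
      finally show ?thesis .
    qed
    also have "(\<Sum>j\<le>M. \<Sum>k<j. real (card (XA k j))) \<le> 2 * C * (\<Sum>u\<in>E. ?W u)"
    proof -
      have "(\<Sum>k<j. real (card (XA k j))) \<le> 2 * C * (\<Sum>u\<in>?E j. ?W u)" for j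
      proof -
        have "(\<Sum>k<j. real (card (XA k j))) \<le> (\<Sum>k<j. real (card (?E j)) * (C * t k))"
          unfolding XA_def using X fin by (intro sum_mono card_meeting_shell_le)
        also have "\<dots> = real (card (?E j)) * C * (\<Sum>k<j. t k)"
          by (simp add: sum_distrib_left mult.assoc)
        also have "\<dots> \<le> real (card (?E j)) * C * (2 * t j)"
        proof (intro mult_left_mono)
          have "(\<Sum>k<j. t k) \<le> (\<Sum>k\<le>j. t k)" using less_imp_le[OF t_pos] by (intro sum_mono2) auto
          then show "(\<Sum>k<j. t k) \<le> 2 * t j" using sum_t_le[of j] by linarith
        qed (use C_pos in auto)
        also have "\<dots> = 2 * C * (real (card (?E j)) * t j)" by simp
        also have "real (card (?E j)) * t j \<le> (\<Sum>u\<in>?E j. ?W u)"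
        proof (rule sum_bounded_below)
          show "t j \<le> ?W u" if "u \<in> ?E j" for u
            using that g_le_W[of u] by (auto simp: level_def)
        qed
        finally show ?thesis using C_pos by simp
      qed
      then have "(\<Sum>j\<le>M. \<Sum>k<j. real (card (XA k j))) \<le> 2 * C * (\<Sum>j\<le>M. \<Sum>u\<in>?E j. ?W u)"
        unfolding sum_distrib_left[of "2 * C"] by (intro sum_mono)
      also have "\<dots> \<le> 2 * C * (\<Sum>u\<in>E. ?W u)"
        using sum_levels_le[OF E(1) W0] C_pos by simp
      finally show ?thesis .
    qed
    also have "(\<Sum>j\<le>M. \<Sum>i\<le>M. real (card (XB j i))) \<le> K1 * (\<Sum>u\<in>E. ?W u)"
    proof -
      have "(\<Sum>i\<le>M. real (card (XB j i))) \<le> K1 * (\<Sum>u\<in>?E j. ?W u)" for j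
      proof -
        let ?A = "C\<^sup>2 / \<kappa>'\<^sup>2"
        have "(\<Sum>i\<le>M. real (card (XB j i)))
            \<le> (\<Sum>i\<le>M. ?A * (real (card (?E j)) * t j * ?n j) * (?n i * (1/2) ^ i))"
        proof (rule sum_mono)
          fix i
          show "real (card (XB j i)) \<le> ?A * (real (card (?E j)) * t j * ?n j) * (?n i * (1/2) ^ i)"
            by (rule card_many_in_later_shell_le)
              (use X fin[of j] \<kappa>' sub in \<open>auto simp: XB_def\<close>)
        qed
        also have "\<dots> = ?A * (real (card (?E j)) * t j * ?n j) * (\<Sum>i\<le>M. ?n i * (1/2) ^ i)"
          by (simp add: sum_distrib_left)
        also have "\<dots> \<le> ?A * (real (card (?E j)) * t j * ?n j) * Z"
          using Z t_pos[of j] by (intro mult_left_mono) auto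
        also have "\<dots> = ?A * Z * (real (card (?E j)) * (t j * ?n j))" by simp
        also have "\<dots> \<le> ?A * Z * (\<Sum>u\<in>?E j. (1 + L) powr (2 * b) * ?W u)"
        proof (intro mult_left_mono sum_bounded_below)
          fix u assume u: "u \<in> ?E j"
          then have gu: "t j \<le> g u" "1 \<le> g u" using g by (auto simp: level_def)
          have "?n j \<le> ((1 + L) * (1 + ln (g u))) powr (2 * b)"
            using radius_le_ln[OF gu(1)] L_pos b_nonneg by (intro powr_mono2) auto
          also have "\<dots> = (1 + L) powr (2 * b) * (1 + ln (g u)) powr (2 * b)"
            by (rule powr_mult)
          finally have "t j * ?n j \<le> g u * ((1 + L) powr (2 * b) * (1 + ln (g u)) powr (2 * b))"
            using gu by (intro mult_mono) auto
          then show "t j * ?n j \<le> (1 + L) powr (2 * b) * ?W u" by (simp add: algebra_simps)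
        qed (use Z0 in auto)
        finally show ?thesis by (simp add: K1_def sum_distrib_left mult.assoc)
      qed
      then have "(\<Sum>j\<le>M. \<Sum>i\<le>M. real (card (XB j i))) \<le> K1 * (\<Sum>j\<le>M. \<Sum>u\<in>?E j. ?W u)"
        unfolding sum_distrib_left[of K1] by (intro sum_mono)
      also have "\<dots> \<le> K1 * (\<Sum>u\<in>E. ?W u)"
        using sum_levels_le[OF E(1) W0] K1 by (simp add: mult_left_mono)
      finally show ?thesis .
    qed
    finally show "real (card X) \<le> (K0 + 2 * C + K1) * (\<Sum>u\<in>E. ?W u)"
      by (simp add: algebra_simps)
  qed
qed

theorem HL_maximal_level_bound:
  assumes "0 < r0" "0 < \<alpha>" "\<alpha> < \<beta>"
  obtains K where "0 < K"
    "\<And>f \<eta>. 0 < \<eta> \<Longrightarrow>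
       emeasure (count_space UNIV) {x \<in> carrier G. ennreal (\<beta> * \<eta>) \<le> HL_maximal G \<G> r0 f x}
       \<le> ennreal K * (\<Sum>\<^sub>\<infinity>x\<in>{x \<in> carrier G. \<alpha> * \<eta> < norm (f x)}.
            ennreal (norm (f x) / \<eta> * (1 + ln (norm (f x) / (\<alpha> * \<eta>))) powr (2 * b)))"
proof -
  have "0 < (\<beta> - \<alpha>) / (2 * \<alpha>)" using assms by simp
  then obtain K where K: "0 < K"
    "\<And>E g X. \<lbrakk>finite E; E \<subseteq> carrier G; \<And>u. u \<in> E \<Longrightarrow> 1 \<le> g u; finite X; X \<subseteq> carrier G;
        \<And>x. x \<in> X \<Longrightarrow> \<exists>r>0. (\<beta> - \<alpha>) / (2 * \<alpha>) * real (card (len_ball G \<G> r))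
          < (\<Sum>u | u \<in> E \<and> len_dist G \<G> x u < r. g u)\<rbrakk>
      \<Longrightarrow> real (card X) \<le> K * (\<Sum>u\<in>E. g u * (1 + ln (g u)) powr (2 * b))"
    using card_large_average_le by blast
  show thesis
  proof (rule that[of "K / \<alpha>"])
    show "0 < K / \<alpha>" using K assms by simp
  next
    fix f :: "'a \<Rightarrow> complex" and \<eta> :: real
    assume \<eta>: "0 < \<eta>"
    define g where "g u = norm (f u) / (\<alpha> * \<eta>)" for u
    define E where "E = {x \<in> carrier G. \<alpha> * \<eta> < norm (f x)}"
    define h where "h u = norm (f u) / \<eta> * (1 + ln (g u)) powr (2 * b)" for u
    have \<alpha>\<eta>: "0 < \<alpha> * \<eta>" using assms \<eta> by simp
    have g1: "1 \<le> g u" if "u \<in> E" for u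
      using that \<alpha>\<eta> by (simp add: g_def E_def)
    have h_eq: "h u = \<alpha> * (g u * (1 + ln (g u)) powr (2 * b))" for u
      using assms \<eta> by (simp add: h_def g_def)
    have h_ge: "\<alpha> \<le> h u" if "u \<in> E" for u
    proof -
      have "1 * 1 \<le> g u * (1 + ln (g u)) powr (2 * b)"
        using g1[OF that] b_nonneg by (intro mult_mono ge_one_powr_ge_zero) auto
      then show ?thesis unfolding h_eq using assms by simp
    qed
    let ?S = "{x \<in> carrier G. ennreal (\<beta> * \<eta>) \<le> HL_maximal G \<G> r0 f x}"
    have "emeasure (count_space UNIV) ?S \<le> ennreal (K / \<alpha>) * (\<Sum>\<^sub>\<infinity>x\<in>E. ennreal (h x))"
    proof (cases "finite E")
      case False
      then have "(\<Sum>\<^sub>\<infinity>x\<in>E. ennreal (h x)) = \<infinity>"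
        using h_ge assms(2) by (intro infsum_superconst_infinite_ennreal[of _ "ennreal \<alpha>"])
          (auto intro: ennreal_leI)
      then show ?thesis using K assms by (simp add: ennreal_mult_top)
    next
      case True
      have large: "\<exists>r>0. (\<beta> - \<alpha>) / (2 * \<alpha>) * real (card (len_ball G \<G> r))
          < (\<Sum>u | u \<in> E \<and> len_dist G \<G> x u < r. g u)" if x: "x \<in> ?S" for x
      proof -
        have "ennreal ((\<alpha> + \<beta>) / 2 * \<eta>) < ennreal (\<beta> * \<eta>)"
          using assms \<eta> by (intro ennreal_lessI) auto
        also have "\<dots> \<le> HL_maximal G \<G> r0 f x" using x by simp
        finally obtain r where r: "r0 < r" and less: "ennreal ((\<alpha> + \<beta>) / 2 * \<eta>) < ennreal
           ((\<Sum>u | u \<in> carrier G \<and> len_dist G \<G> x u < r. norm (f u)) / real (card (len_ball G \<G> r)))"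
          unfolding HL_maximal_def less_SUP_iff by auto
        let ?B = "{u. u \<in> carrier G \<and> len_dist G \<G> x u < r}"
        let ?b = "real (card (len_ball G \<G> r))"
        have b1: "1 \<le> ?b" using one_le_card_ball[of r] r assms by simp
        have B: "finite ?B" "real (card ?B) \<le> ?b" using ball_at[of x r] x by auto
        have "(\<alpha> + \<beta>) / 2 * \<eta> < (\<Sum>u\<in>?B. norm (f u)) / ?b"
          using less assms \<eta> by (subst (asm) ennreal_less_iff) auto
        then have "(\<alpha> + \<beta>) / 2 * \<eta> * ?b < (\<Sum>u\<in>?B. norm (f u))"
          using b1 by (simp add: field_simps)
        also have "\<dots> \<le> (\<Sum>u\<in>?B. \<alpha> * \<eta> + (if u \<in> E then \<alpha> * \<eta> * g u else 0))"
          using \<alpha>\<eta> assms \<eta> by (intro sum_mono) (auto simp: E_def g_def)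
        also have "\<dots> = real (card ?B) * (\<alpha> * \<eta>) + \<alpha> * \<eta> * (\<Sum>u\<in>?B \<inter> E. g u)"
          using B by (simp add: sum.distrib sum.inter_restrict[symmetric] sum_distrib_left)
        also have "\<dots> \<le> ?b * (\<alpha> * \<eta>) + \<alpha> * \<eta> * (\<Sum>u\<in>?B \<inter> E. g u)"
          using B \<alpha>\<eta> by (intro add_right_mono mult_right_mono) auto
        also have "?B \<inter> E = {u. u \<in> E \<and> len_dist G \<G> x u < r}" by (auto simp: E_def)
        finally have "\<eta> * ((\<beta> - \<alpha>) / 2 * ?b) < \<eta> * (\<alpha> * (\<Sum>u | u \<in> E \<and> len_dist G \<G> x u < r. g u))"
          by (simp add: field_simps)
        then have "(\<beta> - \<alpha>) / 2 * ?b < \<alpha> * (\<Sum>u | u \<in> E \<and> len_dist G \<G> x u < r. g u)"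
          using \<eta> by (simp only: mult_less_cancel_left_pos)
        then have "(\<beta> - \<alpha>) / (2 * \<alpha>) * ?b < (\<Sum>u | u \<in> E \<and> len_dist G \<G> x u < r. g u)"
          using assms by (simp add: field_simps)
        then show ?thesis using r assms by (intro exI[of _ r]) auto
      qed
      have "emeasure (count_space UNIV) ?S \<le> ennreal (K / \<alpha> * (\<Sum>u\<in>E. h u))"
      proof (rule emeasure_count_space_le)
        fix X assume "finite X" "X \<subseteq> ?S"
        then have "real (card X) \<le> K * (\<Sum>u\<in>E. g u * (1 + ln (g u)) powr (2 * b))"
          using large g1 True by (intro K(2)) (auto simp: E_def)
        then show "real (card X) \<le> K / \<alpha> * (\<Sum>u\<in>E. h u)"
          using assms by (simp add: h_eq sum_distrib_left[symmetric])
      qed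
      also have "\<dots> = ennreal (K / \<alpha>) * ennreal (\<Sum>u\<in>E. h u)"
        using K assms by (intro ennreal_mult') auto
      also have "ennreal (\<Sum>u\<in>E. h u) = (\<Sum>u\<in>E. ennreal (h u))"
        using h_ge assms by (intro sum_ennreal[symmetric]) (meson less_eq_real_def order_trans)
      finally show ?thesis using True by simp
    qed
    then show "emeasure (count_space UNIV) ?S \<le> ennreal (K / \<alpha>) *
        (\<Sum>\<^sub>\<infinity>x\<in>{x \<in> carrier G. \<alpha> * \<eta> < norm (f x)}.
            ennreal (norm (f x) / \<eta> * (1 + ln (norm (f x) / (\<alpha> * \<eta>))) powr (2 * b)))"
      by (simp only: E_def h_def g_def)
  qed
qed

end

lemma weak_type_1_1_if_shell_correlations:
  assumes "shell_correlations G \<G> L C D 0 t" "0 < r0"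
  shows "weak_type_1_1 G \<G> r0"
proof -
  interpret shell_correlations G \<G> L C D 0 t by fact
  obtain K where K: "0 < K" "\<And>f \<eta>. 0 < \<eta> \<Longrightarrow>
       emeasure (count_space UNIV) {x \<in> carrier G. ennreal (1 * \<eta>) \<le> HL_maximal G \<G> r0 f x}
       \<le> ennreal K * (\<Sum>\<^sub>\<infinity>x\<in>{x \<in> carrier G. 1/2 * \<eta> < norm (f x)}.
            ennreal (norm (f x) / \<eta> * (1 + ln (norm (f x) / (1/2 * \<eta>))) powr (2 * 0)))"
    using HL_maximal_level_bound[of r0 "1/2" 1] assms(2) by auto
  show ?thesis
    unfolding weak_type_1_1_def
  proof (intro exI[of _ K] conjI allI impI K(1))
    fix f :: "'a \<Rightarrow> complex" and \<eta> :: real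
    assume \<eta>: "0 < \<eta>"
    let ?E = "{x \<in> carrier G. 1/2 * \<eta> < norm (f x)}"
    have "(\<Sum>\<^sub>\<infinity>x\<in>?E. ennreal (norm (f x) / \<eta> * (1 + ln (norm (f x) / (1/2 * \<eta>))) powr (2 * 0)))
        \<le> (\<Sum>\<^sub>\<infinity>x\<in>carrier G. ennreal (1 / \<eta>) * ennreal (norm (f x)))"
      using \<eta> by (intro infsum_mono_neutral nonneg_summable_on_complete)
        (auto simp: ennreal_mult[symmetric] intro!: ennreal_leI)
    also have "\<dots> = ennreal (1 / \<eta>) * (\<Sum>\<^sub>\<infinity>x\<in>carrier G. ennreal (norm (f x)))"
      by (rule infsum_cmult_right_ennreal)
    finally have "ennreal K * (\<Sum>\<^sub>\<infinity>x\<in>?E. ennreal (norm (f x) / \<eta> * (1 + ln (norm (f x) / (1/2 * \<eta>))) powr (2 * 0)))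
        \<le> ennreal K * (ennreal (1 / \<eta>) * (\<Sum>\<^sub>\<infinity>x\<in>carrier G. ennreal (norm (f x))))"
      by (rule mult_left_mono) simp
    also have "\<dots> = ennreal (K / \<eta>) * (\<Sum>\<^sub>\<infinity>x\<in>carrier G. ennreal (norm (f x)))"
      using K(1) \<eta> by (simp add: mult.assoc[symmetric] ennreal_mult'[symmetric])
    finally show "emeasure (count_space UNIV) {x \<in> carrier G. ennreal \<eta> \<le> HL_maximal G \<G> r0 f x}
        \<le> ennreal (K / \<eta>) * (\<Sum>\<^sub>\<infinity>x\<in>carrier G. ennreal (norm (f x)))"
      using K(2)[OF \<eta>, of f] by simp
  qed
qed

text \<open>Splitting off the part of \<open>f\<close> above \<open>(1 + \<theta>) / 2 * \<eta>\<close>, rather than above \<open>\<eta>\<close>, keeps the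
  logarithm in \<open>LlogL_sum\<close> away from \<open>0\<close>.\<close>

lemma weak_type_LlogL_at_if_shell_correlations:
  assumes "shell_correlations G \<G> L C D b t" "0 < r0" "1 < \<theta>"
  shows "weak_type_LlogL_at G \<G> r0 (2 * b) \<theta>"
proof -
  interpret shell_correlations G \<G> L C D b t by fact
  define \<alpha> where "\<alpha> = (1 + \<theta>) / 2"
  have \<alpha>: "1 < \<alpha>" "\<alpha> < \<theta>" using assms by (auto simp: \<alpha>_def)
  obtain K where K: "0 < K" "\<And>f \<eta>. 0 < \<eta> \<Longrightarrow>
       emeasure (count_space UNIV) {x \<in> carrier G. ennreal (\<theta> * \<eta>) \<le> HL_maximal G \<G> r0 f x}
       \<le> ennreal K * (\<Sum>\<^sub>\<infinity>x\<in>{x \<in> carrier G. \<alpha> * \<eta> < norm (f x)}.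
            ennreal (norm (f x) / \<eta> * (1 + ln (norm (f x) / (\<alpha> * \<eta>))) powr (2 * b)))"
    using HL_maximal_level_bound[of r0 \<alpha> \<theta>] assms(2) \<alpha> by auto
  define c where "c = (1 + 1 / ln \<alpha>) powr (2 * b)"
  have l: "0 < ln \<alpha>" using \<alpha> by simp
  have "0 < 1 + 1 / ln \<alpha>" using l by (simp add: add_pos_pos)
  then have c: "0 < c" by (simp add: c_def)
  show ?thesis
    unfolding weak_type_LlogL_at_def
  proof (intro exI[of _ "K * c"] conjI allI impI)
    fix f :: "'a \<Rightarrow> complex" and \<eta> :: real
    assume \<eta>: "0 < \<eta>"
    let ?E = "{x \<in> carrier G. \<alpha> * \<eta> < norm (f x)}"
    let ?h = "\<lambda>x. norm (f x) / \<eta> * ln (norm (f x) / \<eta>) powr (2 * b)"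
    have pointwise: "norm (f x) / \<eta> * (1 + ln (norm (f x) / (\<alpha> * \<eta>))) powr (2 * b) \<le> c * ?h x"
      if "x \<in> ?E" for x
    proof -
      define y where "y = norm (f x) / \<eta>"
      have y: "\<alpha> < y" using that \<eta> by (simp add: y_def field_simps)
      have "ln \<alpha> \<le> ln y" using y \<alpha> by simp
      then have "1 \<le> ln y / ln \<alpha>" using l by simp
      moreover have "ln (y / \<alpha>) = ln y - ln \<alpha>" using y \<alpha> by (simp add: ln_div)
      moreover have "(1 + 1 / ln \<alpha>) * ln y = ln y + ln y / ln \<alpha>" by (simp add: distrib_right)
      ultimately have "1 + ln (y / \<alpha>) \<le> (1 + 1 / ln \<alpha>) * ln y"
        using l by linarith
      then have "(1 + ln (y / \<alpha>)) powr (2 * b) \<le> ((1 + 1 / ln \<alpha>) * ln y) powr (2 * b)"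
        using y \<alpha> b_nonneg by (intro powr_mono2) auto
      also have "\<dots> = c * ln y powr (2 * b)"
        unfolding c_def by (rule powr_mult)
      finally have "y * (1 + ln (y / \<alpha>)) powr (2 * b) \<le> y * (c * ln y powr (2 * b))"
        using y \<alpha> by (intro mult_left_mono) auto
      then show ?thesis by (simp add: y_def algebra_simps)
    qed
    have sub: "?E \<subseteq> {x \<in> carrier G. \<eta> < norm (f x)}"
      using \<alpha> \<eta> by (auto intro: less_trans[rotated])
    have "(\<Sum>\<^sub>\<infinity>x\<in>?E. ennreal (norm (f x) / \<eta> * (1 + ln (norm (f x) / (\<alpha> * \<eta>))) powr (2 * b)))
        \<le> (\<Sum>\<^sub>\<infinity>x\<in>{x \<in> carrier G. \<eta> < norm (f x)}. ennreal c * ennreal (?h x))"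
    proof (intro infsum_mono_neutral nonneg_summable_on_complete)
      fix x assume "x \<in> ?E \<inter> {x \<in> carrier G. \<eta> < norm (f x)}"
      then show "ennreal (norm (f x) / \<eta> * (1 + ln (norm (f x) / (\<alpha> * \<eta>))) powr (2 * b))
          \<le> ennreal c * ennreal (?h x)"
        using pointwise[of x] c by (simp add: ennreal_mult'[symmetric] ennreal_leI)
    qed (use sub in auto)
    also have "\<dots> = ennreal c * LlogL_sum G (2 * b) f \<eta>"
      unfolding LlogL_sum_def by (rule infsum_cmult_right_ennreal)
    finally have "ennreal K * (\<Sum>\<^sub>\<infinity>x\<in>?E. ennreal (norm (f x) / \<eta> * (1 + ln (norm (f x) / (\<alpha> * \<eta>))) powr (2 * b)))
        \<le> ennreal K * (ennreal c * LlogL_sum G (2 * b) f \<eta>)"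
      by (rule mult_left_mono) simp
    also have "\<dots> = ennreal (K * c) * LlogL_sum G (2 * b) f \<eta>"
      using K(1) by (simp add: ennreal_mult' mult.assoc)
    finally show "emeasure (count_space UNIV) {x \<in> carrier G. ennreal (\<theta> * \<eta>) \<le> HL_maximal G \<G> r0 f x}
        \<le> ennreal (K * c) * LlogL_sum G (2 * b) f \<eta>"
      using K(2)[OF \<eta>, of f] by (rule order_trans[rotated])
  qed (use K c in simp)
qed

lemma ex_shell_correlations:
  assumes "group G" "length_function G \<G>" "0 \<le> b"
    and corr: "rapid_decay_correlations G \<G> b" and growth: "almost_exact_growth G \<G>"
  obtains L C D t where "shell_correlations G \<G> L C D b t"
proof -
  obtain q :: real and d :: nat and L0 where q: "1 < q" "0 < L0"
    and gr: "\<And>L. L \<ge> L0 \<Longrightarrow> \<exists>C\<ge>1. \<forall>r\<ge>1.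
        inverse C * r ^ d * q powr r \<le> real (card (shell G \<G> L r)) \<and>
        real (card (shell G \<G> L r)) \<le> C * r ^ d * q powr r"
    using growth unfolding almost_exact_growth_def by blast
  obtain L1 where "0 < L1"
    and co: "\<And>L. L \<ge> L1 \<Longrightarrow> \<exists>C>0. \<forall>A B. \<forall>r\<ge>1.
        A \<subseteq> carrier G \<longrightarrow> finite A \<longrightarrow> A \<noteq> {} \<longrightarrow>
        B \<subseteq> carrier G \<longrightarrow> finite B \<longrightarrow> B \<noteq> {} \<longrightarrow>
        real (card {(u, v) \<in> A \<times> B. r \<le> len_dist G \<G> u v \<and> len_dist G \<G> u v < r + L})
          \<le> C * r powr b * sqrt (real (card A)) * sqrt (real (card B))
              * sqrt (real (card (shell G \<G> L r)))"
    using corr unfolding rapid_decay_correlations_def by blast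
  define L where "L = max (max L0 L1) (ln 8 / ln q)"
  have L: "L0 \<le> L" "L1 \<le> L" "0 < L" "ln 8 / ln q \<le> L" using q by (auto simp: L_def)
  obtain Cg where Cg: "1 \<le> Cg" "\<And>r. 1 \<le> r \<Longrightarrow>
        inverse Cg * r ^ d * q powr r \<le> real (card (shell G \<G> L r))"
        "\<And>r. 1 \<le> r \<Longrightarrow> real (card (shell G \<G> L r)) \<le> Cg * r ^ d * q powr r"
    using gr[OF L(1)] by blast
  obtain Cc where Cc: "0 < Cc" "\<And>A B r. \<lbrakk>1 \<le> r;
        A \<subseteq> carrier G; finite A; A \<noteq> {}; B \<subseteq> carrier G; finite B; B \<noteq> {}\<rbrakk> \<Longrightarrow>
        real (card {(u, v) \<in> A \<times> B. r \<le> len_dist G \<G> u v \<and> len_dist G \<G> u v < r + L})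
          \<le> Cc * r powr b * sqrt (real (card A)) * sqrt (real (card B))
              * sqrt (real (card (shell G \<G> L r)))"
    using co[OF L(2)] by blast
  define Q where "Q = q powr L"
  have "ln 8 \<le> L * ln q" using L(4) q by (simp add: field_simps)
  then have "exp (ln 8) \<le> exp (L * ln q)" by (simp only: exp_le_cancel_iff)
  then have Q: "8 \<le> Q" using q by (simp add: Q_def powr_def)
  define t where "t k = (1 + real k * L) ^ d * Q ^ k" for k
  define C where "C = max (Cg * q) (Cc * sqrt (Cg * q))"
  have C: "Cg * q \<le> C" "Cc * sqrt (Cg * q) \<le> C" by (auto simp: C_def)
  have Cgq: "1 \<le> Cg * q" using Cg(1) q mult_mono[of 1 Cg 1 q] by simp
  have n: "1 \<le> 1 + real k * L" for k using L by simp
  have tpos: "0 < t k" for k using n[of k] Q by (simp add: t_def)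
  have qn: "(1 + real k * L) ^ d * q powr (1 + real k * L) = q * t k" for k
    using q by (simp add: t_def Q_def powr_add powr_powr[symmetric] powr_realpow[symmetric] mult.commute)
  have lower: "t k \<le> C * real (card (shell G \<G> L (1 + real k * L)))" for k
  proof -
    have "t k \<le> q * t k" using q tpos[of k] by simp
    also have "\<dots> = Cg * (inverse Cg * (1 + real k * L) ^ d * q powr (1 + real k * L))"
      unfolding qn[of k, symmetric] using Cg(1) by (simp add: mult.assoc)
    also have "\<dots> \<le> Cg * real (card (shell G \<G> L (1 + real k * L)))"
      using Cg(1) Cg(2)[OF n[of k]] by (intro mult_left_mono) auto
    also have "\<dots> \<le> C * real (card (shell G \<G> L (1 + real k * L)))"
    proof (intro mult_right_mono)
      have "Cg * 1 \<le> Cg * q" using Cg(1) q by (intro mult_left_mono) auto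
      then show "Cg \<le> C" using C(1) by simp
    qed auto
    finally show ?thesis .
  qed
  have upper': "real (card (shell G \<G> L (1 + real k * L))) \<le> Cg * q * t k" for k
    using Cg(3)[OF n[of k]] qn[of k] by (simp add: mult.assoc)
  interpret group G by fact
  have "shell_correlations G \<G> L C ((1 + L) ^ d * Q) b t"
  proof
    show "0 < C" using C(1) Cgq by linarith
    show "1 \<le> (1 + L) ^ d * Q" using mult_mono[of 1 "(1 + L) ^ d" 1 Q] Q L by simp
    show "t 0 = 1" by (simp add: t_def)
    show "8 * t k \<le> t (Suc k)" for k
    proof -
      have "8 * t k = (1 + real k * L) ^ d * (8 * Q ^ k)" by (simp add: t_def)
      also have "\<dots> \<le> (1 + real (Suc k) * L) ^ d * (Q * Q ^ k)"
        using L Q by (intro mult_mono power_mono) (auto simp: algebra_simps)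
      finally show ?thesis by (simp add: t_def)
    qed
    show "t (Suc k) \<le> (1 + L) ^ d * Q * t k" for k
    proof -
      have "(1 + real (Suc k) * L) ^ d \<le> ((1 + L) * (1 + real k * L)) ^ d"
        using L by (intro power_mono) (auto simp: algebra_simps)
      then have "(1 + real (Suc k) * L) ^ d * (Q * Q ^ k) \<le> ((1 + L) * (1 + real k * L)) ^ d * (Q * Q ^ k)"
        using Q by (intro mult_right_mono) auto
      then show ?thesis by (simp add: t_def power_mult_distrib mult_ac)
    qed
    show "real (card (shell G \<G> L (1 + real k * L))) \<le> C * t k" for k
      using upper'[of k] mult_right_mono[OF C(1) less_imp_le[OF tpos[of k]]] by linarith
    fix A B :: "'a set" and k
    assume AB: "A \<subseteq> carrier G" "finite A" "A \<noteq> {}" "B \<subseteq> carrier G" "finite B" "B \<noteq> {}"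
    let ?s = "(1 + real k * L) powr b * sqrt (real (card A)) * sqrt (real (card B))"
    have "real (card {(u, v) \<in> A \<times> B. 1 + real k * L \<le> len_dist G \<G> u v
                    \<and> len_dist G \<G> u v < 1 + real k * L + L})
        \<le> Cc * ?s * sqrt (real (card (shell G \<G> L (1 + real k * L))))"
      using Cc(2)[OF n[of k] AB] by (simp add: mult.assoc)
    also have "\<dots> \<le> Cc * ?s * sqrt (Cg * q * t k)"
      using upper'[of k] Cc(1) by (intro mult_left_mono real_sqrt_le_mono) auto
    also have "\<dots> = Cc * sqrt (Cg * q) * (?s * sqrt (t k))" by (simp add: real_sqrt_mult)
    also have "\<dots> \<le> C * (?s * sqrt (t k))"
      using C(2) tpos[of k] by (intro mult_right_mono) auto
    finally show "real (card {(u, v) \<in> A \<times> B. 1 + real k * L \<le> len_dist G \<G> u v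
                    \<and> len_dist G \<G> u v < 1 + real k * L + L})
        \<le> C * (1 + real k * L) powr b * sqrt (real (card A)) * sqrt (real (card B)) * sqrt (t k)"
      by (simp add: mult.assoc)
  qed (use assms L lower in auto)
  then show thesis by (rule that)
qed

theorem theorem10:
  fixes G :: "('a, 'm) monoid_scheme" and \<G> :: "'a \<Rightarrow> real" and b r0 :: real
  assumes "group G" and "countable (carrier G)"
    and "length_function G \<G>"
    and "b \<ge> 0" and "rapid_decay_correlations G \<G> b"
    and "almost_exact_growth G \<G>"
    and "r0 > 0"
  shows "weak_type_LlogL G \<G> r0 (2 * b)"
proof -
  obtain L C D t where sc: "shell_correlations G \<G> L C D b t"
    using assms by (elim ex_shell_correlations)
  show ?thesis
    unfolding weak_type_LlogL_def
    using sc assms(7) weak_type_1_1_if_shell_correlations weak_type_LlogL_at_if_shell_correlations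
    by auto
qed

end
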